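(* For all positive integers $a$ and $n$, a $\mathrm{LC}(a^n)$ exists, i.e. there is a latin cube of order $an$ with $n$ pairwise disjoint subcubes each of order $a$.
   Context: A latin cube of order $N$ is an $N\times N\times N$ array on $N$ symbols such that any two cells whose coordinates differ in exactly one position contain different symbols; a subcube is an $m\times m\times m$ subarray (indices in each coordinate from chosen $m$-sets) that is itself a latin cube of order $m$; subcubes are disjoint if they share no index in any coordinate and no symbol. $\mathrm{LC}(a^n)$ denotes a latin cube of order $an$ with $n$ pairwise disjoint subcubes of order $a$. *)

theory Defs
  imports Main
begin

text \<open>
  An array is a total function \<open>L\<close>; only its values at cells \<open>(x, y, z)\<close> with
  \<open>x \<in> X\<close>, \<open>y \<in> Y\<close>, \<open>z \<in> Z\<close> matter. Allowing arbitrary index sets lets the same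
  definition apply to a whole cube and to its subarrays.
\<close>

definition latin_cube_on ::
  "nat \<Rightarrow> 'a set \<Rightarrow> 'b set \<Rightarrow> 'c set \<Rightarrow> 's set \<Rightarrow> ('a \<Rightarrow> 'b \<Rightarrow> 'c \<Rightarrow> 's) \<Rightarrow> bool" where
  "latin_cube_on N X Y Z S L \<longleftrightarrow>
     finite X \<and> card X = N \<and> finite Y \<and> card Y = N \<and> finite Z \<and> card Z = N \<and>
     finite S \<and> card S = N \<and>
     (\<forall>x\<in>X. \<forall>y\<in>Y. \<forall>z\<in>Z. L x y z \<in> S) \<and>
     (\<forall>x\<in>X. \<forall>x'\<in>X. \<forall>y\<in>Y. \<forall>z\<in>Z. x \<noteq> x' \<longrightarrow> L x y z \<noteq> L x' y z) \<and>
     (\<forall>x\<in>X. \<forall>y\<in>Y. \<forall>y'\<in>Y. \<forall>z\<in>Z. y \<noteq> y' \<longrightarrow> L x y z \<noteq> L x y' z) \<and>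
     (\<forall>x\<in>X. \<forall>y\<in>Y. \<forall>z\<in>Z. \<forall>z'\<in>Z. z \<noteq> z' \<longrightarrow> L x y z \<noteq> L x y z')"

definition latin_cube :: "nat \<Rightarrow> (nat \<Rightarrow> nat \<Rightarrow> nat \<Rightarrow> nat) \<Rightarrow> bool" where
  "latin_cube N L \<longleftrightarrow> latin_cube_on N {..<N} {..<N} {..<N} {..<N} L"

type_synonym subarray = "nat set \<times> nat set \<times> nat set"

fun subarray_symbols :: "(nat \<Rightarrow> nat \<Rightarrow> nat \<Rightarrow> nat) \<Rightarrow> subarray \<Rightarrow> nat set" where
  "subarray_symbols L (X, Y, Z) = {L x y z | x y z. x \<in> X \<and> y \<in> Y \<and> z \<in> Z}"

fun subcube :: "nat \<Rightarrow> (nat \<Rightarrow> nat \<Rightarrow> nat \<Rightarrow> nat) \<Rightarrow> nat \<Rightarrow> subarray \<Rightarrow> bool" where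
  "subcube N L m (X, Y, Z) \<longleftrightarrow>
     X \<subseteq> {..<N} \<and> Y \<subseteq> {..<N} \<and> Z \<subseteq> {..<N} \<and> (\<exists>S. latin_cube_on m X Y Z S L)"

fun disjoint_subarrays ::
  "(nat \<Rightarrow> nat \<Rightarrow> nat \<Rightarrow> nat) \<Rightarrow> subarray \<Rightarrow> subarray \<Rightarrow> bool" where
  "disjoint_subarrays L (X, Y, Z) (X', Y', Z') \<longleftrightarrow>
     X \<inter> X' = {} \<and> Y \<inter> Y' = {} \<and> Z \<inter> Z' = {} \<and>
     subarray_symbols L (X, Y, Z) \<inter> subarray_symbols L (X', Y', Z') = {}"

definition LC :: "nat \<Rightarrow> nat \<Rightarrow> (nat \<Rightarrow> nat \<Rightarrow> nat \<Rightarrow> nat) \<Rightarrow> bool" where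
  "LC a n L \<longleftrightarrow>
     latin_cube (a * n) L \<and>
     (\<exists>Q :: nat \<Rightarrow> subarray.
        (\<forall>i<n. subcube (a * n) L a (Q i)) \<and>
        (\<forall>i<n. \<forall>j<n. i \<noteq> j \<longrightarrow> disjoint_subarrays L (Q i) (Q j)))"

end

theory Submission
  imports Defs
begin

text \<open>
  The cube is \<open>x + y - z\<close> over the cyclic group of order \<open>a n\<close>. Each coset of the subgroup of
  order \<open>a\<close>, that is, each residue class modulo \<open>n\<close>, is closed under this operation, so using the
  class of \<open>i\<close> in all three coordinates gives a subcube whose symbols are that class again.
\<close>

text \<open>The sum is formed in \<open>int\<close> because subtraction on \<open>nat\<close>
  truncates at 0. For \<open>N > 0\<close> the residue is nonnegative, so \<open>nat\<close> loses
  nothing.\<close>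

definition cyclic_cube :: "nat \<Rightarrow> nat \<Rightarrow> nat \<Rightarrow> nat \<Rightarrow> nat" where
  "cyclic_cube N x y z = nat ((int x + int y - int z) mod int N)"

lemma int_cyclic_cube:
  "N > 0 \<Longrightarrow> int (cyclic_cube N x y z) = (int x + int y - int z) mod int N"
  by (simp add: cyclic_cube_def)

lemma cyclic_cube_less: "N > 0 \<Longrightarrow> cyclic_cube N x y z < N"
  by (simp add: cyclic_cube_def nat_less_iff)

lemma eq_if_dvd_diff:
  fixes u v N :: nat
  assumes "u < N" "v < N" "int N dvd int u - int v"
  shows "u = v"
  using assms by (metis mod_eq_dvd_iff mod_less of_nat_eq_iff zmod_int)

lemma cyclic_cube_eq_iff:
  assumes "N > 0"
  shows "cyclic_cube N x y z = cyclic_cube N x' y' z' \<longleftrightarrow>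
    int N dvd (int x + int y - int z) - (int x' + int y' - int z')"
  using assms by (metis int_cyclic_cube mod_eq_dvd_iff of_nat_eq_iff)

text \<open>Changing one coordinate changes \<open>x + y - z\<close> by plus or minus the difference
  of two indices below \<open>N\<close>, which \<open>N\<close> divides only if they agree. Stating
  this for any closed \<open>A\<close> covers the whole cube and the subcubes at once, with
  \<open>A\<close> also as symbol set.\<close>

lemma cyclic_cube_latin_on:
  assumes "A \<subseteq> {..<N}" and "card A = m" and "N > 0"
    and "\<And>x y z. x \<in> A \<Longrightarrow> y \<in> A \<Longrightarrow> z \<in> A \<Longrightarrow> cyclic_cube N x y z \<in> A"
  shows "latin_cube_on m A A A A (cyclic_cube N)"
proof -
  have "finite A" using assms(1) by (rule finite_subset) simp
  moreover have "u = v" if "u \<in> A" "v \<in> A" "int N dvd int u - int v" for u v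
    using that assms(1) by (blast intro: eq_if_dvd_diff)
  ultimately show ?thesis
    using assms(2-4) unfolding latin_cube_on_def
    by (auto simp: cyclic_cube_eq_iff)
qed

definition residue_class :: "nat \<Rightarrow> nat \<Rightarrow> nat \<Rightarrow> nat set" where
  "residue_class N n i = {x. x < N \<and> x mod n = i}"

text \<open>Division by \<open>n\<close> parametrises the class: a member is
  \<open>k * n + i\<close> with quotient \<open>k\<close>, and as \<open>i < n\<close>, lying below
  \<open>a * n\<close> amounts to \<open>k < a\<close>.\<close>

lemma card_residue_class:
  assumes "i < n"
  shows "card (residue_class (a * n) n i) = a"
proof -
  have "residue_class (a * n) n i = (\<lambda>k. k * n + i) ` {..<a}"
  proof (intro equalityI subsetI)
    fix x assume "x \<in> residue_class (a * n) n i"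
    then have "x div n < a" "x = x div n * n + i"
      using assms by (auto simp: residue_class_def less_mult_imp_div_less)
    then show "x \<in> (\<lambda>k. k * n + i) ` {..<a}" by blast
  next
    fix x assume "x \<in> (\<lambda>k. k * n + i) ` {..<a}"
    then obtain k where k: "k < a" "x = k * n + i" by blast
    have "k * n + i < Suc k * n" using assms by simp
    also have "\<dots> \<le> a * n" using k(1) by (intro mult_le_mono1) simp
    finally show "x \<in> residue_class (a * n) n i"
      using k(2) assms by (simp add: residue_class_def)
  qed
  moreover have "inj_on (\<lambda>k. k * n + i) {..<a}"
    using assms by (auto simp: inj_on_def)
  ultimately show ?thesis by (simp add: card_image)
qed

text \<open>Since \<open>n\<close> divides \<open>N\<close>, reduction modulo \<open>N\<close>
  preserves residues modulo \<open>n\<close>, and there the value is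
  \<open>i + i - i = i\<close>.\<close>

lemma cyclic_cube_residue_class:
  assumes "N > 0" and "n dvd N"
    and "x \<in> residue_class N n i" "y \<in> residue_class N n i" "z \<in> residue_class N n i"
  shows "cyclic_cube N x y z \<in> residue_class N n i"
proof -
  have mods: "int x mod int n = int i" "int y mod int n = int i" "int z mod int n = int i"
    using assms(3-5) by (auto simp: residue_class_def simp flip: zmod_int)
  have "int (cyclic_cube N x y z) mod int n = (int x + int y - int z) mod int n"
    using assms(1,2) by (simp add: int_cyclic_cube mod_mod_cancel)
  also have "\<dots> = (int x mod int n + int y mod int n - int z mod int n) mod int n"
    by (intro mod_diff_cong mod_add_cong) simp_all
  also have "\<dots> = int x mod int n" using mods by (metis add_diff_cancel_right' mod_mod_trivial)
  finally have "cyclic_cube N x y z mod n = i"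
    using mods by (metis of_nat_eq_iff zmod_int)
  then show ?thesis using assms(1) by (simp add: residue_class_def cyclic_cube_less)
qed

theorem theorem11:
  fixes a n :: nat
  assumes "a > 0" and "n > 0"
  shows "\<exists>L. LC a n L"
proof -
  let ?N = "a * n"
  let ?R = "residue_class ?N n"
  let ?L = "cyclic_cube ?N"
  have N: "?N > 0" using assms by simp
  have R_sub: "?R i \<subseteq> {..<?N}" for i by (auto simp: residue_class_def)
  have R_disjoint: "?R i \<inter> ?R j = {}" if "i \<noteq> j" for i j
    using that by (auto simp: residue_class_def)
  have closed: "?L x y z \<in> ?R i" if "x \<in> ?R i" "y \<in> ?R i" "z \<in> ?R i" for i x y z
    using N that by (intro cyclic_cube_residue_class) auto
  \<comment> \<open>Here \<open>A\<close> is all of \<open>{..<?N}\<close>, so closure is just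
    \<open>cyclic_cube_less\<close>.\<close>
  have "latin_cube ?N ?L"
    unfolding latin_cube_def using N by (intro cyclic_cube_latin_on) (auto simp: cyclic_cube_less)
  moreover have "subcube ?N ?L a (?R i, ?R i, ?R i)" if "i < n" for i
    using cyclic_cube_latin_on[OF R_sub card_residue_class[OF that] N closed] R_sub by auto
  moreover have "disjoint_subarrays ?L (?R i, ?R i, ?R i) (?R j, ?R j, ?R j)" if "i \<noteq> j" for i j
  proof -
    \<comment> \<open>By closure the symbols of a subcube lie in its own index class, so
      disjointness of the classes settles indices and symbols alike.\<close>
    have "subarray_symbols ?L (?R k, ?R k, ?R k) \<subseteq> ?R k" for k
      using closed by auto
    then show ?thesis
      using R_disjoint[OF that] unfolding disjoint_subarrays.simps by blast
  qed
  ultimately have "LC a n ?L"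
    unfolding LC_def by (intro conjI exI[of _ "\<lambda>i. (?R i, ?R i, ?R i)"]) auto
  then show ?thesis by blast
qed

end
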